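(* Let $A\in\mathbb{R}^{p\times n}$ be a full-rank matrix with rows $A_1,\dots,A_p$, and let $b\in\mathbb{R}^p$. Let $Q\in\mathbb{R}^{n\times n}$ be a symmetric matrix that is non-negative over $\mathrm{null}(A)$, i.e. $u^\top Qu\ge0$ for all $u\in\mathrm{null}(A)$. Then there exists a linear combination of the functions $x\mapsto x_jA_ix-x_jb_i$ ($j\in\{1,\dots,n\}$, $i\in\{1,\dots,p\}$; these vanish whenever $Ax=b$) which, when added to $x^\top Qx$, yields a quadratic function whose quadratic part is given by a positive semidefinite matrix. Equivalently, letting $\overline A_{j\swarrow i}$ denote the $n\times n$ matrix whose $j$-th row is $A_i$ and whose other rows are zero, there exist $\lambda_{ji}\in\mathbb{R}$ ($j\in\{1,\dots,n\}$, $i\in\{1,\dots,p\}$) such that $$Q+\sum_{j=1}^n\sum_{i=1}^p\lambda_{ji}\big(\overline A_{j\swarrow i}^\top+\overline A_{j\swarrow i}\big)\succeq0.$$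
   Context: $\mathrm{null}(A)=\{u\in\mathbb{R}^n:\ Au=0\}$; $M\succeq0$ means $M$ is symmetric positive semidefinite. *)

theory Defs
  imports "HOL-Analysis.Analysis"
begin

definition symmetric_mat :: "real ^ 'n ^ 'n \<Rightarrow> bool" where
  "symmetric_mat M \<longleftrightarrow> transpose M = M"

definition psd :: "real ^ 'n ^ 'n \<Rightarrow> bool" where
  "psd M \<longleftrightarrow> symmetric_mat M \<and> (\<forall>x. 0 \<le> x \<bullet> (M *v x))"

definition null_space :: "real ^ 'n ^ 'p \<Rightarrow> (real ^ 'n) set" where
  "null_space A = {u. A *v u = 0}"

(* No shape is singled out: full row rank if A is wide, full column rank if A is tall. *)
definition full_rank :: "real ^ 'n ^ 'p \<Rightarrow> bool" where
  "full_rank A \<longleftrightarrow> rank A = min CARD('p) CARD('n)"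

definition constraint_product ::
  "real ^ 'n ^ 'p \<Rightarrow> real ^ 'p \<Rightarrow> 'n \<Rightarrow> 'p \<Rightarrow> real ^ 'n \<Rightarrow> real" where
  "constraint_product A b j i x = x $ j * (row i A \<bullet> x) - x $ j * b $ i"

(* Symmetry makes the matrix M of the quadratic part of f unique. *)
definition has_quadratic_part :: "(real ^ 'n \<Rightarrow> real) \<Rightarrow> real ^ 'n ^ 'n \<Rightarrow> bool" where
  "has_quadratic_part f M \<longleftrightarrow>
     symmetric_mat M \<and> (\<exists>c d. \<forall>x. f x = x \<bullet> (M *v x) + c \<bullet> x + d)"

definition row_placed :: "real ^ 'n ^ 'p \<Rightarrow> 'n \<Rightarrow> 'p \<Rightarrow> real ^ 'n ^ 'n" where
  "row_placed A j i = (\<chi> k. if k = j then row i A else 0)"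

end

theory Submission
  imports Defs
begin

text \<open>
  Choose a generalized inverse \<open>G\<close> with \<open>A G A = A\<close>. Then \<open>P = I - G A\<close> maps into the null space
  of \<open>A\<close>, so \<open>P\<^sup>T Q P\<close> is positive semidefinite. Expanding it gives
  \<open>Q + L A + (L A)\<^sup>T\<close> with \<open>L = (1/2) A\<^sup>T G\<^sup>T Q G - Q G\<close>, and the entries of \<open>L\<close> are the
  required multipliers (doubled when the functions rather than the matrices are combined).
\<close>

lemma matrix_generalized_inverse_exists:
  fixes A :: "real ^ 'n ^ 'p"
  obtains G :: "real ^ 'p ^ 'n" where "A ** G ** A = A"
proof -
  \<comment> \<open>\<open>g\<close> is a linear right inverse of \<open>A\<close> on the range of
    \<open>A\<close> only. This suffices, because in \<open>A ** G ** A\<close> the matrix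
    \<open>G\<close> of \<open>g\<close> is applied to vectors of the form \<open>A *v x\<close>
    alone.\<close>
  obtain g where g: "linear g" "\<forall>v \<in> range ((*v) A). A *v g v = v"
    using real_vector.linear_exists_right_inverse_on[of "(*v) A" UNIV]
    by (auto simp: Real_Vector_Spaces.linear_def[symmetric])
  have "A ** matrix g ** A = A"
    using g by (simp add: matrix_eq matrix_vector_mul_assoc[symmetric] matrix_works)
  then show thesis by (rule that)
qed

lemma transpose_add: "transpose (A + B) = transpose A + transpose B"
  by (simp add: transpose_def vec_eq_iff)

lemma transpose_sum: "transpose (sum f S) = (\<Sum>i\<in>S. transpose (f i))"
  by (simp add: transpose_def vec_eq_iff)

lemma inner_transpose_matrix_vector:
  fixes M :: "real ^ 'n ^ 'm"
  shows "x \<bullet> (transpose M *v y) = (M *v x) \<bullet> y"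
  by (metis dot_lmul_matrix inner_commute transpose_matrix_vector)

text \<open>Row \<open>k\<close> receives contributions only from the terms with
  \<open>j = k\<close>; they add up to the combination of the rows of \<open>A\<close> with
  coefficients \<open>l k i\<close>, which is row \<open>k\<close> of the product. Multipliers thus
  become an arbitrary matrix factor to the left of \<open>A\<close>.\<close>

lemma sum_row_placed:
  fixes A :: "real ^ 'n ^ 'p" and l :: "'n \<Rightarrow> 'p \<Rightarrow> real"
  shows "(\<Sum>j\<in>UNIV. \<Sum>i\<in>UNIV. l j i *\<^sub>R row_placed A j i) = (\<chi> j i. l j i) ** A"
proof -
  have "(\<Sum>j\<in>UNIV. \<Sum>i\<in>UNIV. l j i * row_placed A j i $ k $ m)
      = (\<Sum>i\<in>UNIV. l k i * A $ i $ m)" for k m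
  proof -
    have "(\<Sum>i\<in>UNIV. l j i * row_placed A j i $ k $ m)
        = (if j = k then \<Sum>i\<in>UNIV. l j i * A $ i $ m else 0)" for j
      by (auto simp: row_placed_def row_def)
    then show ?thesis by simp
  qed
  then show ?thesis
    by (simp add: vec_eq_iff matrix_matrix_mult_def)
qed

lemma sum_symmetrized_row_placed:
  fixes A :: "real ^ 'n ^ 'p" and l :: "'n \<Rightarrow> 'p \<Rightarrow> real"
  shows "(\<Sum>j\<in>UNIV. \<Sum>i\<in>UNIV. l j i *\<^sub>R (transpose (row_placed A j i) + row_placed A j i))
    = transpose ((\<chi> j i. l j i) ** A) + (\<chi> j i. l j i) ** A"
  by (simp add: sum_row_placed[symmetric] transpose_sum transpose_scalar
      scaleR_add_right sum.distrib)

lemma constraint_product_eq: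
  "constraint_product A b j i x = x $ j * ((A *v x) $ i - b $ i)"
  by (simp add: constraint_product_def row_def inner_vec_def matrix_vector_mult_def
      algebra_simps)

text \<open>Each function is the coordinate \<open>x $ j\<close> times the residual of the
  \<open>i\<close>-th equation, so a combination of them is a bilinear form in \<open>x\<close> and
  \<open>A *v x - b\<close>, with the multipliers as its matrix.\<close>

lemma sum_constraint_product:
  fixes A :: "real ^ 'n ^ 'p"
  shows "(\<Sum>j\<in>UNIV. \<Sum>i\<in>UNIV. l j i * constraint_product A b j i x)
    = x \<bullet> ((\<chi> j i. l j i) *v (A *v x - b))"
  by (simp add: constraint_product_eq inner_vec_def matrix_vector_mult_def[of "\<chi> j i. l j i"]
      sum_distrib_left mult_ac)

lemma psd_completion:
  fixes A :: "real ^ 'n ^ 'p" and Q :: "real ^ 'n ^ 'n"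
  assumes sym: "symmetric_mat Q" and nonneg: "\<forall>u \<in> null_space A. 0 \<le> u \<bullet> (Q *v u)"
  obtains L :: "real ^ 'p ^ 'n" where "psd (Q + (transpose (L ** A) + L ** A))"
proof -
  obtain G :: "real ^ 'p ^ 'n" where G: "A ** G ** A = A"
    by (rule matrix_generalized_inverse_exists)
  define R where "R = G ** A"
  define L where "L = (1/2) *\<^sub>R (transpose R ** Q ** G) - Q ** G"
  define T where "T = transpose (L ** A) + L ** A"
  have "symmetric_mat (Q + T)"
    using sym by (simp add: T_def symmetric_mat_def transpose_add add.commute)
  moreover have "0 \<le> x \<bullet> ((Q + T) *v x)" for x
  proof -
    define r where "r = R *v x"
    have Qsym: "y \<bullet> (Q *v z) = z \<bullet> (Q *v y)" for y z
      using sym inner_transpose_matrix_vector[of y Q z]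
      by (simp add: symmetric_mat_def inner_commute)
    \<comment> \<open>Since \<open>A ** R = A\<close>, the vector \<open>x - r\<close> is the image
      of \<open>x\<close> under the map \<open>P\<close> into the null space, where \<open>Q\<close>
      is non-negative.\<close>
    have "A *v (x - r) = 0"
      using G by (simp add: r_def R_def matrix_vector_mult_diff_distrib
          matrix_vector_mul_assoc matrix_mul_assoc)
    then have "0 \<le> (x - r) \<bullet> (Q *v (x - r))"
      using nonneg by (simp add: null_space_def)
    \<comment> \<open>The two cross terms agree by symmetry of \<open>Q\<close>. The factor 2 is
      pulled out so that the bracket becomes the quadratic form of \<open>L ** A\<close>; this
      dictates the 1/2 in \<open>L\<close>.\<close>
    also have "\<dots> = x \<bullet> (Q *v x) + 2 * (1/2 * (r \<bullet> (Q *v r)) - x \<bullet> (Q *v r))"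
      using Qsym[of r x]
      by (simp add: matrix_vector_mult_diff_distrib inner_diff_left inner_diff_right)
    also have "1/2 * (r \<bullet> (Q *v r)) - x \<bullet> (Q *v r) = x \<bullet> (L ** A *v x)"
    proof -
      have "L ** A *v x = (1/2) *\<^sub>R (transpose R *v (Q *v r)) - Q *v r"
        by (simp add: L_def r_def R_def matrix_vector_mul_assoc[symmetric]
            matrix_vector_mult_diff_rdistrib scaleR_matrix_vector_assoc[symmetric]
            del: transpose_matrix_vector)
      then show ?thesis
        by (simp add: inner_diff_right inner_transpose_matrix_vector r_def
            del: transpose_matrix_vector)
    qed
    \<comment> \<open>A matrix and its transpose have the same quadratic form, so the two summands
      of \<open>T\<close> account for the factor 2.\<close>
    also have "x \<bullet> (Q *v x) + 2 * (x \<bullet> (L ** A *v x)) = x \<bullet> ((Q + T) *v x)"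
      by (simp add: T_def matrix_vector_mult_add_rdistrib inner_add_right
          inner_transpose_matrix_vector inner_commute del: transpose_matrix_vector)
    finally show ?thesis .
  qed
  ultimately show thesis by (intro that[of L]) (simp add: psd_def T_def)
qed

theorem proposition2:
  fixes A :: "real ^ 'n ^ 'p" and b :: "real ^ 'p" and Q :: "real ^ 'n ^ 'n"
  assumes "full_rank A"
    and "symmetric_mat Q"
    and "\<forall>u \<in> null_space A. 0 \<le> u \<bullet> (Q *v u)"
  shows "(\<forall>j i x. A *v x = b \<longrightarrow> constraint_product A b j i x = 0) \<and>
    (\<exists>(\<mu> :: 'n \<Rightarrow> 'p \<Rightarrow> real) M.
       has_quadratic_part
         (\<lambda>x. x \<bullet> (Q *v x) + (\<Sum>j\<in>UNIV. \<Sum>i\<in>UNIV. \<mu> j i * constraint_product A b j i x)) M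
       \<and> psd M) \<and>
    (\<exists>l :: 'n \<Rightarrow> 'p \<Rightarrow> real.
       psd (Q + (\<Sum>j\<in>UNIV. \<Sum>i\<in>UNIV.
              l j i *\<^sub>R (transpose (row_placed A j i) + row_placed A j i))))"
proof -
  obtain L :: "real ^ 'p ^ 'n" where L: "psd (Q + (transpose (L ** A) + L ** A))"
    using psd_completion assms(2,3) by blast
  define M where "M = Q + (transpose (L ** A) + L ** A)"
  \<comment> \<open>The functions with multipliers \<open>L $ j $ i\<close> contribute
    \<open>L ** A\<close> once, whereas \<open>M\<close> contains it together with its transpose;
    hence the doubled multipliers. The vector \<open>b\<close> enters only the linear term.\<close>
  have "x \<bullet> (Q *v x) + (\<Sum>j\<in>UNIV. \<Sum>i\<in>UNIV. (2 * L $ j $ i) * constraint_product A b j i x)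
      = x \<bullet> (M *v x) + (- 2 *\<^sub>R (L *v b)) \<bullet> x + 0" for x
  proof -
    have "(\<Sum>j\<in>UNIV. \<Sum>i\<in>UNIV. (2 * L $ j $ i) * constraint_product A b j i x)
        = 2 * (x \<bullet> (L *v (A *v x - b)))"
      using sum_constraint_product[of "\<lambda>j i. L $ j $ i" A b x]
      by (simp add: sum_distrib_left[symmetric] mult.assoc)
    moreover have "x \<bullet> (transpose (L ** A) *v x) = x \<bullet> ((L ** A) *v x)"
      by (simp add: inner_transpose_matrix_vector inner_commute del: transpose_matrix_vector)
    ultimately show ?thesis
      by (simp add: M_def matrix_vector_mult_add_rdistrib matrix_vector_mult_diff_distrib
          inner_add_right inner_diff_right matrix_vector_mul_assoc inner_commute
          del: transpose_matrix_vector)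
  qed
  then have "has_quadratic_part
      (\<lambda>x. x \<bullet> (Q *v x) + (\<Sum>j\<in>UNIV. \<Sum>i\<in>UNIV. (2 * L $ j $ i) * constraint_product A b j i x)) M"
    using L unfolding has_quadratic_part_def psd_def M_def by blast
  moreover have "psd (Q + (\<Sum>j\<in>UNIV. \<Sum>i\<in>UNIV.
      L $ j $ i *\<^sub>R (transpose (row_placed A j i) + row_placed A j i)))"
    using L by (simp add: sum_symmetrized_row_placed)
  ultimately show ?thesis
    using L unfolding M_def
    by (intro conjI exI[of _ "\<lambda>j i. 2 * L $ j $ i"] exI[of _ "\<lambda>j i. L $ j $ i"] exI[of _ M])
      (auto simp: constraint_product_eq M_def)
qed

end
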